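(* Let $(X_t)_{t\in\mathbb{N}}$ be i.i.d. random variables distributed as $X$, with mean $\mu>0$ and finite standard deviation $\sigma>0$. Let $S_t=X_1+\dots+X_t$ and $Z_t=(X_1)^2+\dots+(X_t)^2$, with $S_0=Z_0=0$. For $\Delta,\Gamma>0$ let $\tau_0=\theta_0=0$ and, for $n\in\mathbb{N}$, $$\tau_n=\inf\{t\ge\tau_{n-1}:S_t-S_{\tau_{n-1}}\ge\Delta\},\qquad \theta_n=\inf\{t\ge\theta_{n-1}:Z_t-Z_{\theta_{n-1}}\ge\Gamma\}.$$ Let $N(t)=\max\{n:\tau_n\le t\}$, $\tau(t)=\tau_{N(t)}$, $M(t)=\max\{n:\theta_n\le t\}$, $\theta(t)=\theta_{M(t)}$, and $$\hat\mu_t=\frac{N(t)\,\Delta}{\tau(t)},\qquad \hat\sigma_t=\sqrt{\frac{\Gamma\,M(t)}{\theta(t)}-(\hat\mu_t)^2}.$$ If $\mathsf{E}[|X|^3]<\infty$, then $\hat\sigma_t\to\sigma$ in probability as $\Delta,\Gamma,t\to\infty$ so that $\Delta=o(t)$ and $\Gamma=o(t)$.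
   Context: The law of $X$ is fixed; only $\Delta,\Gamma,t$ vary. On events where $\hat\mu_t$ or $\hat\sigma_t$ is undefined ($\tau(t)=0$, $\theta(t)=0$, or a negative quantity under the square root) they may be given any fixed value. *)

theory Defs
  imports "HOL-Probability.Probability" "HOL-Library.Landau_Symbols"
begin

definition path_S :: "(nat \<Rightarrow> 'a \<Rightarrow> real) \<Rightarrow> 'a \<Rightarrow> nat \<Rightarrow> real" where
  "path_S X \<omega> t = (\<Sum>k = 1..t. X k \<omega>)"

definition path_Z :: "(nat \<Rightarrow> 'a \<Rightarrow> real) \<Rightarrow> 'a \<Rightarrow> nat \<Rightarrow> real" where
  "path_Z X \<omega> t = (\<Sum>k = 1..t. (X k \<omega>)\<^sup>2)"

text \<open>
  Successive times at which a path \<open>W\<close> has gained at least \<open>d\<close> since the previous such time;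
  the infimum of the empty set is \<open>\<infinity>\<close>. If \<open>crossing W d n = \<infinity>\<close>, the set below is empty, so all
  later crossing times are \<open>\<infinity>\<close> too and the value of \<open>the_enat \<infinity>\<close> is never used.
\<close>

primrec crossing :: "(nat \<Rightarrow> real) \<Rightarrow> real \<Rightarrow> nat \<Rightarrow> enat" where
  "crossing W d 0 = 0"
| "crossing W d (Suc n) =
     Inf {enat t | t. crossing W d n \<le> enat t \<and> W t - W (the_enat (crossing W d n)) \<ge> d}"

text \<open>
  For \<open>d > 0\<close> the crossing times are strictly increasing as long as they are finite, so the set
  in \<open>crossing_count\<close> is finite (it contains \<open>0\<close>), and \<open>last_crossing\<close> is a genuine finite time.
\<close>

definition crossing_count :: "(nat \<Rightarrow> real) \<Rightarrow> real \<Rightarrow> nat \<Rightarrow> nat" where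
  "crossing_count W d t = Max {n. crossing W d n \<le> enat t}"

definition last_crossing :: "(nat \<Rightarrow> real) \<Rightarrow> real \<Rightarrow> nat \<Rightarrow> nat" where
  "last_crossing W d t = the_enat (crossing W d (crossing_count W d t))"

definition mu_hat :: "(nat \<Rightarrow> 'a \<Rightarrow> real) \<Rightarrow> real \<Rightarrow> nat \<Rightarrow> 'a \<Rightarrow> real" where
  "mu_hat X \<Delta> t \<omega> =
     real (crossing_count (path_S X \<omega>) \<Delta> t) * \<Delta> / real (last_crossing (path_S X \<omega>) \<Delta> t)"

definition sigma_hat_sq :: "(nat \<Rightarrow> 'a \<Rightarrow> real) \<Rightarrow> real \<Rightarrow> real \<Rightarrow> nat \<Rightarrow> 'a \<Rightarrow> real" where
  "sigma_hat_sq X \<Delta> \<Gamma> t \<omega> =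
     \<Gamma> * real (crossing_count (path_Z X \<omega>) \<Gamma> t) / real (last_crossing (path_Z X \<omega>) \<Gamma> t)
       - (mu_hat X \<Delta> t \<omega>)\<^sup>2"

text \<open>
  The parameter \<open>c\<close> is the arbitrary fixed value taken where the estimator is undefined. This
  includes the points where \<open>mu_hat\<close> is undefined, so that its value there (\<open>0\<close>, by
  \<open>x / 0 = 0\<close>) is irrelevant. The library's \<open>sqrt\<close> is \<open>- sqrt \<bar>x\<bar>\<close> for negative \<open>x\<close>, hence the
  explicit guard on the radicand.
\<close>

definition sigma_hat ::
    "real \<Rightarrow> (nat \<Rightarrow> 'a \<Rightarrow> real) \<Rightarrow> real \<Rightarrow> real \<Rightarrow> nat \<Rightarrow> 'a \<Rightarrow> real" where
  "sigma_hat c X \<Delta> \<Gamma> t \<omega> =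
     (if last_crossing (path_S X \<omega>) \<Delta> t = 0 \<or> last_crossing (path_Z X \<omega>) \<Gamma> t = 0
         \<or> sigma_hat_sq X \<Delta> \<Gamma> t \<omega> < 0
      then c else sqrt (sigma_hat_sq X \<Delta> \<Gamma> t \<omega>))"

text \<open>
  Convergence in probability to a constant along a filter. Measurability is part of the notion:
  otherwise the measure of a non-measurable deviation event would be \<open>0\<close> by convention.
\<close>

definition tendsto_in_prob ::
    "'a measure \<Rightarrow> ('i \<Rightarrow> 'a \<Rightarrow> real) \<Rightarrow> real \<Rightarrow> 'i filter \<Rightarrow> bool" where
  "tendsto_in_prob M Y l F \<longleftrightarrow>
     (\<forall>i. Y i \<in> borel_measurable M) \<and>
     (\<forall>\<epsilon>>0. ((\<lambda>i. measure M {\<omega> \<in> space M. \<bar>Y i \<omega> - l\<bar> > \<epsilon>}) \<longlongrightarrow> 0) F)"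

end

theory Submission
  imports Defs "HOL-Real_Asymp.Real_Asymp"
begin

text \<open>
  It suffices to show \<open>mu_hat \<rightarrow> m\<close> in probability for every i.i.d. sequence \<open>X\<close> of integrable
  variables with mean \<open>m > 0\<close>: applied to \<open>X\<close> and to the squares \<open>X\<^sup>2\<close>, this makes the radicand
  converge to \<open>E X\<^sup>2 - \<mu>\<^sup>2 = \<sigma>\<^sup>2 > 0\<close>.

  Let \<open>v\<close> be the last crossing time before \<open>t\<close> and \<open>n\<close> the number of crossings. Each crossing
  overshoots \<open>\<Delta>\<close> by at most the absolute value of the jump made at that time, hence by at most
  \<open>\<epsilon>\<Delta> + \<bar>X k\<bar> 1{\<bar>X k\<bar> > \<epsilon>\<Delta>}\<close>. Since \<open>n\<Delta> \<le> S v \<le> \<Sum>k\<le>t. \<bar>X k\<bar>\<close>, the expected total overshoot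
  \<open>S v - n\<Delta>\<close> is at most \<open>t (\<epsilon> E\<bar>X\<bar> + E[\<bar>X\<bar>; \<bar>X\<bar> > \<epsilon>\<Delta>]) = o(t)\<close>. A maximal weak law of large
  numbers gives \<open>S k = m k + o(t)\<close> uniformly in \<open>k \<le> t\<close>, so \<open>S t - S v < \<Delta> = o(t)\<close> forces
  \<open>v = t - o(t)\<close>, and therefore \<open>n\<Delta> / v = m + o(1)\<close>.
\<close>

subsection \<open>Crossing times of a path\<close>

declare crossing.simps(2) [simp del]

text \<open>Comparing with a finite time replaces the infimum over \<open>enat\<close> by an
  existential over naturals. Minimality, monotonicity and measurability of crossing times are all
  derived from this form.\<close>

lemma crossing_Suc_le_iff:
  "crossing W d (Suc n) \<le> enat s \<longleftrightarrow>
     (\<exists>u v. crossing W d n = enat u \<and> u \<le> v \<and> v \<le> s \<and> d \<le> W v - W u)"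
proof -
  define A where "A = {enat t | t. crossing W d n \<le> enat t \<and> W t - W (the_enat (crossing W d n)) \<ge> d}"
  \<comment> \<open>\<open>Inf_less_iff\<close> speaks of strict inequality only, so "at most
    \<open>s\<close>" is traded for "below \<open>Suc s\<close>".\<close>
  have less_Suc: "x < enat (Suc s) \<longleftrightarrow> x \<le> enat s" for x
    by (cases x) auto
  have "Inf A \<le> enat s \<longleftrightarrow> Inf A < enat (Suc s)"
    by (simp only: less_Suc)
  also have "\<dots> \<longleftrightarrow> (\<exists>x\<in>A. x \<le> enat s)"
    unfolding Inf_less_iff by (simp only: less_Suc)
  also have "\<dots> \<longleftrightarrow> (\<exists>u v. crossing W d n = enat u \<and> u \<le> v \<and> v \<le> s \<and> d \<le> W v - W u)"
    unfolding A_def by (cases "crossing W d n") auto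
  finally show ?thesis
    by (simp add: A_def crossing.simps(2))
qed

text \<open>A finite infimum is attained: the witness \<open>v'\<close> satisfies
  \<open>v' \<le> v\<close>, while every qualifying time is at least \<open>v\<close>.\<close>

lemma crossing_SucE:
  assumes "crossing W d (Suc n) = enat v"
  obtains u where "crossing W d n = enat u" "u \<le> v" "d \<le> W v - W u"
    "\<And>s. u \<le> s \<Longrightarrow> s < v \<Longrightarrow> W s - W u < d"
proof -
  obtain u v' where u: "crossing W d n = enat u" "u \<le> v'" "v' \<le> v" "d \<le> W v' - W u"
    using crossing_Suc_le_iff[of W d n v] assms by auto
  have least: "v \<le> s" if "u \<le> s" "d \<le> W s - W u" for s
    using crossing_Suc_le_iff[of W d n s] assms u(1) that by auto
  have "v' = v"
    using least[OF u(2,4)] u(3) by simp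
  with u least show thesis
    by (intro that[of u]) (auto simp: not_le[symmetric])
qed

lemma crossing_less_Suc:
  assumes "d > 0" "crossing W d (Suc n) \<le> enat s"
  shows "crossing W d n < enat s"
proof -
  obtain u v where uv: "crossing W d n = enat u" "u \<le> v" "v \<le> s" "d \<le> W v - W u"
    using assms(2) by (auto simp: crossing_Suc_le_iff)
  then have "u \<noteq> v" using \<open>d > 0\<close> by auto
  with uv show ?thesis by simp
qed

lemma crossing_le_antimono:
  assumes "d > 0" "m \<le> n" "crossing W d n \<le> enat s"
  shows "crossing W d m \<le> enat s"
  using assms(2,3)
  by (induction n rule: dec_induct) (auto dest: crossing_less_Suc[OF assms(1)])

text \<open>Finite crossing times increase strictly when \<open>d > 0\<close>. This bounds the index
  set in \<open>crossing_count\<close>, so that its \<open>Max\<close> is genuine.\<close>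

lemma crossing_ge:
  assumes "d > 0" "crossing W d n \<le> enat s"
  shows "n \<le> s"
  using assms(2)
proof (induction n arbitrary: s)
  case (Suc n)
  then obtain r where "crossing W d n = enat r" "r < s"
    using crossing_less_Suc[OF assms(1)] by (metis enat_ord_simps(2) less_enatE)
  with Suc.IH[of r] show ?case by simp
qed simp

text \<open>The index set in \<open>crossing_count\<close> is finite and downward closed, so a
  single failure at \<open>Suc k\<close> pins down its maximum.\<close>

lemma crossing_count_eq_iff:
  assumes "d > 0"
  shows "crossing_count W d t = k \<longleftrightarrow>
    crossing W d k \<le> enat t \<and> \<not> crossing W d (Suc k) \<le> enat t"
proof -
  let ?A = "{n. crossing W d n \<le> enat t}"
  have "?A \<subseteq> {..t}"
    using crossing_ge[OF assms] by auto
  then have fin: "finite ?A"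
    by (rule finite_subset) simp
  have ne: "?A \<noteq> {}"
    by (auto intro!: exI[of _ 0] simp: zero_enat_def)
  have "Max ?A = k \<longleftrightarrow> k \<in> ?A \<and> (\<forall>n\<in>?A. n \<le> k)"
    by (rule Max_eq_iff[OF fin ne])
  also have "\<dots> \<longleftrightarrow> crossing W d k \<le> enat t \<and> \<not> crossing W d (Suc k) \<le> enat t"
  proof safe
    assume "\<forall>n\<in>?A. n \<le> k" "crossing W d (Suc k) \<le> enat t"
    then have "Suc k \<le> k" by blast
    then show False by simp
  next
    fix n assume "\<not> crossing W d (Suc k) \<le> enat t" "crossing W d n \<le> enat t"
    then show "n \<le> k"
      using crossing_le_antimono[OF assms, of "Suc k" n] by (meson not_less_eq_eq)
  qed
  finally show ?thesis
    by (simp add: crossing_count_def)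
qed

text \<open>The third claim holds because a gain of \<open>d\<close> after the last crossing and by
  time \<open>t\<close> would produce one more crossing, against maximality of the count.\<close>

lemma last_crossing:
  assumes "d > 0"
  shows "crossing W d (crossing_count W d t) = enat (last_crossing W d t)" (is ?eq)
    and "last_crossing W d t \<le> t" (is ?le)
    and "\<And>s. last_crossing W d t \<le> s \<Longrightarrow> s \<le> t \<Longrightarrow> W s - W (last_crossing W d t) < d"
proof -
  have *: "crossing W d (crossing_count W d t) \<le> enat t"
      "\<not> crossing W d (Suc (crossing_count W d t)) \<le> enat t"
    using crossing_count_eq_iff[OF assms, of W t] by auto
  show ?eq
    unfolding last_crossing_def using *(1) by (cases "crossing W d (crossing_count W d t)") auto
  with *(1) show ?le by simp
  show "W s - W (last_crossing W d t) < d"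
    if "last_crossing W d t \<le> s" "s \<le> t" for s
    using *(2) that unfolding crossing_Suc_le_iff \<open>?eq\<close>
    by (metis enat.inject not_le)
qed

subsection \<open>Overshoot\<close>

text \<open>The tail part of the absolute value beyond the threshold \<open>e\<close>. It serves
  both as the bound for large jumps in the overshoot and as the truncation remainder in the law of
  large numbers.\<close>

definition excess :: "real \<Rightarrow> real \<Rightarrow> real" where
  "excess e x = (if \<bar>x\<bar> > e then \<bar>x\<bar> else 0)"

lemma excess_nonneg: "0 \<le> excess e x"
  and excess_le_abs: "excess e x \<le> \<bar>x\<bar>"
  and abs_le_excess: "0 \<le> e \<Longrightarrow> \<bar>x\<bar> \<le> e + excess e x"
  by (auto simp: excess_def)

text \<open>Just before a crossing the gain is still below \<open>d\<close>, so the overshoot is at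
  most the final jump, hence at most \<open>e\<close> plus its excess. Distinct crossings are
  charged to distinct times, so each excess term is counted at most once.\<close>

lemma crossing_overshoot:
  fixes \<xi> :: "nat \<Rightarrow> real"
  defines "W \<equiv> \<lambda>s. \<Sum>k=1..s. \<xi> k"
  assumes "d > 0" "e \<ge> 0" "crossing W d n = enat v"
  shows "real n * d \<le> W v" "W v \<le> real n * (d + e) + (\<Sum>k=1..v. excess e (\<xi> k))"
proof -
  have "real n * d \<le> W v \<and> W v \<le> real n * (d + e) + (\<Sum>k=1..v. excess e (\<xi> k))"
    using assms(4)
  proof (induction n arbitrary: v)
    case 0
    then show ?case by (simp add: zero_enat_def W_def)
  next
    case (Suc n)
    obtain u where u: "crossing W d n = enat u" "u \<le> v" "d \<le> W v - W u"
      "\<And>s. u \<le> s \<Longrightarrow> s < v \<Longrightarrow> W s - W u < d"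
      using crossing_SucE[OF Suc.prems] by metis
    have "u \<noteq> v"
      using u(3) \<open>d > 0\<close> by auto
    \<comment> \<open>Since \<open>d > 0\<close> rules out \<open>u = v\<close>, the crossing has a
      predecessor \<open>w \<ge> u\<close>, at which the gain is below \<open>d\<close>.\<close>
    then obtain w where w: "v = Suc w" "u \<le> w"
      using u(2) by (metis le_less not_less0 less_Suc_eq_le old.nat.exhaust)
    have "W v = W w + \<xi> v"
      unfolding W_def w(1) by simp
    moreover have "W w - W u < d"
      using u(4)[of w] w by simp
    moreover have "\<xi> v \<le> e + excess e (\<xi> v)"
      using abs_le_excess[OF \<open>e \<ge> 0\<close>, of "\<xi> v"] by simp
    moreover have "(\<Sum>k=1..v. excess e (\<xi> k)) = (\<Sum>k=1..w. excess e (\<xi> k)) + excess e (\<xi> v)"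
      unfolding w(1) by simp
    moreover have "(\<Sum>k=1..u. excess e (\<xi> k)) \<le> (\<Sum>k=1..w. excess e (\<xi> k))"
      using w(2) by (intro sum_mono2) (auto simp: excess_nonneg)
    ultimately show ?case
      using Suc.IH[OF u(1)] u(3) by (simp add: algebra_simps)
  qed
  then show "real n * d \<le> W v" "W v \<le> real n * (d + e) + (\<Sum>k=1..v. excess e (\<xi> k))"
    by auto
qed

text \<open>The deterministic core: on one path, a uniform law of large numbers up to
  \<open>T\<close> and a small overshoot bound already control the estimator. Randomness enters
  later, through the probability of these two conditions.\<close>

lemma mu_hat_close:
  fixes m \<delta> \<epsilon> d :: real
  assumes "d > 0" "\<delta> > 0" "\<epsilon> > 0" "m > 0" "T > 0" "6 * \<delta> \<le> m"
    and d: "d \<le> \<delta> * real T"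
    and lln: "\<And>k. k \<le> T \<Longrightarrow> \<bar>path_S X \<omega> k - m * real k\<bar> \<le> \<delta> * real T"
    and over: "\<epsilon> * (\<Sum>k=1..T. \<bar>X k \<omega>\<bar>) + (\<Sum>k=1..T. excess (\<epsilon> * d) (X k \<omega>)) \<le> \<delta> * real T"
  shows "last_crossing (path_S X \<omega>) d T \<noteq> 0" "\<bar>mu_hat X d T \<omega> - m\<bar> \<le> 4 * \<delta>"
proof -
  let ?W = "path_S X \<omega>"
  have W: "?W = (\<lambda>s. \<Sum>k=1..s. X k \<omega>)"
    by (auto simp: path_S_def)
  define v n where "v = last_crossing ?W d T" and "n = crossing_count ?W d T"
  note last = last_crossing[OF \<open>d > 0\<close>, of ?W T, folded v_def n_def]
  have n: "real n * d \<le> ?W v"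
      "?W v \<le> real n * (d + \<epsilon> * d) + (\<Sum>k=1..v. excess (\<epsilon> * d) (X k \<omega>))"
    using crossing_overshoot[of d "\<epsilon> * d" "\<lambda>k. X k \<omega>" n v] last(1) \<open>d > 0\<close> \<open>\<epsilon> > 0\<close> by (auto simp: W)
  have "?W v \<le> (\<Sum>k=1..v. \<bar>X k \<omega>\<bar>)"
    unfolding W by (intro sum_mono) auto
  also have "\<dots> \<le> (\<Sum>k=1..T. \<bar>X k \<omega>\<bar>)"
    using last(2) by (intro sum_mono2) auto
  \<comment> \<open>The overshoot threshold is \<open>\<epsilon> * d\<close>, so \<open>n\<close>
    crossings cost \<open>\<epsilon> * (n * d)\<close>. Bounding \<open>n * d\<close> by the sum of
    absolute values removes the random count \<open>n\<close>.\<close>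
  finally have "\<epsilon> * (real n * d) \<le> \<epsilon> * (\<Sum>k=1..T. \<bar>X k \<omega>\<bar>)"
    using n(1) \<open>\<epsilon> > 0\<close> by (intro mult_left_mono) auto
  moreover have "(\<Sum>k=1..v. excess (\<epsilon> * d) (X k \<omega>)) \<le> (\<Sum>k=1..T. excess (\<epsilon> * d) (X k \<omega>))"
    using last(2) by (intro sum_mono2) (auto simp: excess_nonneg)
  ultimately have R: "?W v - real n * d \<le> \<delta> * real T"
    using n(2) over by (simp add: algebra_simps)
  have Wv: "\<bar>?W v - m * real v\<bar> \<le> \<delta> * real T" and WT: "\<bar>?W T - m * real T\<bar> \<le> \<delta> * real T"
    using lln last(2) by auto
  have "?W T - ?W v < d"
    using last(3)[of T] last(2) by simp
  \<comment> \<open>Two law of large numbers errors and \<open>d\<close> contribute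
    \<open>\<delta> * T\<close> each; \<open>6 * \<delta> \<le> m\<close> then yields
    \<open>v \<ge> T / 2\<close>.\<close>
  then have "m * real T - m * real v \<le> 3 * (\<delta> * real T)"
    using Wv WT d by linarith
  also have "\<dots> \<le> m * real T / 2"
    using mult_right_mono[OF \<open>6 * \<delta> \<le> m\<close>, of "real T"] by simp
  finally have "m * (real T / 2) \<le> m * real v"
    by simp
  then have v: "real T / 2 \<le> real v"
    using \<open>m > 0\<close> by simp
  then show "last_crossing ?W d T \<noteq> 0"
    using \<open>T > 0\<close> by (auto simp: v_def)
  \<comment> \<open>One \<open>\<delta> * T\<close> comes from the overshoot and one from the law of
    large numbers; \<open>T \<le> 2 * v\<close> turns the sum into a multiple of
    \<open>v\<close>.\<close>
  have "\<bar>real n * d - m * real v\<bar> \<le> 2 * (\<delta> * real T)"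
    using R Wv n(1) by linarith
  also have "\<dots> = 4 * \<delta> * (real T / 2)"
    by simp
  also have "\<dots> \<le> 4 * \<delta> * real v"
    using v \<open>\<delta> > 0\<close> by (intro mult_left_mono) auto
  finally have "\<bar>real n * d - m * real v\<bar> / real v \<le> 4 * \<delta>"
    using v \<open>T > 0\<close> by (simp add: divide_simps)
  moreover have "mu_hat X d T \<omega> - m = (real n * d - m * real v) / real v"
    using v \<open>T > 0\<close> by (simp add: mu_hat_def v_def[symmetric] n_def[symmetric] divide_simps)
  ultimately show "\<bar>mu_hat X d T \<omega> - m\<bar> \<le> 4 * \<delta>"
    by (simp add: abs_divide)
qed

subsection \<open>Measurability\<close>

text \<open>By \<open>crossing_Suc_le_iff\<close> the events "at most \<open>s\<close>" are
  countable combinations of measurable ones. As \<open>enat\<close> is countable, it is enough to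
  recover the singletons from them.\<close>

lemma measurable_crossing [measurable (raw)]:
  assumes [measurable]: "\<And>s. (\<lambda>\<omega>. W \<omega> s) \<in> borel_measurable M"
  shows "(\<lambda>\<omega>. crossing (W \<omega>) d n) \<in> measurable M (count_space UNIV)"
proof (induction n)
  case (Suc n)
  have le [measurable]: "Measurable.pred M (\<lambda>\<omega>. crossing (W \<omega>) d (Suc n) \<le> enat s)" for s
    unfolding crossing_Suc_le_iff using Suc by measurable
  have eq: "Measurable.pred M (\<lambda>\<omega>. crossing (W \<omega>) d (Suc n) = x)" for x
  proof (cases x)
    case (enat s)
    have "crossing (W \<omega>) d (Suc n) = x \<longleftrightarrow> crossing (W \<omega>) d (Suc n) \<le> enat s \<and>
        (\<forall>r<s. \<not> crossing (W \<omega>) d (Suc n) \<le> enat r)" for \<omega>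
      unfolding enat by (cases "crossing (W \<omega>) d (Suc n)") (auto simp: not_le le_less)
    then show ?thesis by simp
  next
    case infinity
    have "crossing (W \<omega>) d (Suc n) = x \<longleftrightarrow> (\<forall>s. \<not> crossing (W \<omega>) d (Suc n) \<le> enat s)" for \<omega>
      unfolding infinity by (cases "crossing (W \<omega>) d (Suc n)") auto
    then show ?thesis by simp
  qed
  have "(\<lambda>\<omega>. crossing (W \<omega>) d (Suc n)) -` {x} \<inter> space M \<in> sets M" for x
    using predE[OF eq[of x]]
    by (simp add: vimage_def Int_def conj_commute)
  then show ?case
    by (simp add: measurable_count_space_eq2_countable)
qed simp

lemma measurable_crossing_count [measurable (raw)]:
  assumes [measurable]: "\<And>s. (\<lambda>\<omega>. W \<omega> s) \<in> borel_measurable M"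
  shows "(\<lambda>\<omega>. crossing_count (W \<omega>) d t) \<in> measurable M (count_space UNIV)"
  unfolding crossing_count_def by measurable

lemma measurable_last_crossing [measurable (raw)]:
  assumes [measurable]: "\<And>s. (\<lambda>\<omega>. W \<omega> s) \<in> borel_measurable M"
  shows "(\<lambda>\<omega>. last_crossing (W \<omega>) d t) \<in> measurable M (count_space UNIV)"
  unfolding last_crossing_def by measurable

lemma borel_measurable_sigma_hat:
  assumes [measurable]: "\<And>k. k \<ge> 1 \<Longrightarrow> X k \<in> borel_measurable M"
  shows "sigma_hat c X d g t \<in> borel_measurable M"
proof -
  have [measurable]: "(\<lambda>\<omega>. path_S X \<omega> s) \<in> borel_measurable M"
      "(\<lambda>\<omega>. path_Z X \<omega> s) \<in> borel_measurable M" for s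
    unfolding path_S_def path_Z_def by measurable
  have [measurable]: "(\<lambda>\<omega>. sigma_hat_sq X d g t \<omega>) \<in> borel_measurable M"
    unfolding sigma_hat_sq_def mu_hat_def by measurable
  show ?thesis
    unfolding sigma_hat_def[abs_def] by measurable
qed

subsection \<open>Laws of large numbers\<close>

text \<open>Only a first moment is assumed, so the locale can be instantiated both at
  \<open>X\<close> and at the squares, whose integrability is a second moment of the original
  variable.\<close>

locale iid_sequence = prob_space M for M :: "'a measure" +
  fixes X :: "nat \<Rightarrow> 'a \<Rightarrow> real" and X0 :: "'a \<Rightarrow> real"
  assumes measurable_X0 [measurable]: "X0 \<in> borel_measurable M"
    and indep: "indep_vars (\<lambda>_. borel) X {1..}"
    and distr_eq: "k \<ge> 1 \<Longrightarrow> distr M borel (X k) = distr M borel X0"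
    and integrable_X0: "integrable M X0"
begin

lemma measurable_X [measurable]: "k \<ge> 1 \<Longrightarrow> X k \<in> borel_measurable M"
  using indep by (auto simp: indep_vars_def2)

lemma distr_comp:
  assumes [measurable]: "g \<in> borel_measurable borel" and "k \<ge> 1"
  shows "distr M borel (\<lambda>\<omega>. g (X k \<omega>)) = distr M borel (\<lambda>\<omega>. g (X0 \<omega>))"
proof -
  have "distr (distr M borel (X k)) borel g = distr (distr M borel X0) borel g"
    using distr_eq[OF \<open>k \<ge> 1\<close>] by simp
  then show ?thesis
    using \<open>k \<ge> 1\<close> by (simp add: distr_distr comp_def)
qed

lemma
  fixes g :: "real \<Rightarrow> real"
  assumes [measurable]: "g \<in> borel_measurable borel" and "k \<ge> 1"
  shows expectation_comp: "expectation (\<lambda>\<omega>. g (X k \<omega>)) = expectation (\<lambda>\<omega>. g (X0 \<omega>))"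
    and integrable_comp: "integrable M (\<lambda>\<omega>. g (X k \<omega>)) \<longleftrightarrow> integrable M (\<lambda>\<omega>. g (X0 \<omega>))"
proof -
  have [measurable]: "X k \<in> borel_measurable M"
    using \<open>k \<ge> 1\<close> by simp
  show "expectation (\<lambda>\<omega>. g (X k \<omega>)) = expectation (\<lambda>\<omega>. g (X0 \<omega>))"
    using integral_distr[of "X k" M borel g] integral_distr[of X0 M borel g] distr_eq[OF \<open>k \<ge> 1\<close>]
    by simp
  show "integrable M (\<lambda>\<omega>. g (X k \<omega>)) \<longleftrightarrow> integrable M (\<lambda>\<omega>. g (X0 \<omega>))"
    using integrable_distr_eq[of "X k" M borel g] integrable_distr_eq[of X0 M borel g]
      distr_eq[OF \<open>k \<ge> 1\<close>]
    by simp
qed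

text \<open>Markov's inequality, with the expectation of the sum computed by linearity and equality
  in law.\<close>

lemma prob_sum_ge_le:
  fixes g :: "real \<Rightarrow> real"
  assumes [measurable]: "g \<in> borel_measurable borel"
    and "\<And>x. 0 \<le> g x" "integrable M (\<lambda>\<omega>. g (X0 \<omega>))" "a > 0"
  shows "prob {\<omega> \<in> space M. a \<le> (\<Sum>k=1..n. g (X k \<omega>))} \<le> real n * expectation (\<lambda>\<omega>. g (X0 \<omega>)) / a"
proof -
  have int: "integrable M (\<lambda>\<omega>. g (X k \<omega>))" if "k \<in> {1..n}" for k
    using integrable_comp[OF assms(1), of k] assms(3) that by simp
  have "prob {\<omega> \<in> space M. a \<le> (\<Sum>k=1..n. g (X k \<omega>))} \<le> expectation (\<lambda>\<omega>. \<Sum>k=1..n. g (X k \<omega>)) / a"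
    by (rule integral_Markov_inequality_measure[where A = "space M"])
      (use int assms in \<open>auto intro!: sum_nonneg Bochner_Integration.integrable_sum\<close>)
  also have "expectation (\<lambda>\<omega>. \<Sum>k=1..n. g (X k \<omega>)) = (\<Sum>k=1..n. expectation (\<lambda>\<omega>. g (X k \<omega>)))"
    using int by (rule Bochner_Integration.integral_sum)
  also have "\<dots> = (\<Sum>k=1..n. expectation (\<lambda>\<omega>. g (X0 \<omega>)))"
    by (intro sum.cong refl expectation_comp) auto
  finally show ?thesis by simp
qed

lemma measurable_excess [measurable]: "excess e \<in> borel_measurable borel"
  unfolding excess_def[abs_def] by measurable

lemma integrable_excess: "integrable M (\<lambda>\<omega>. excess e (X0 \<omega>))"
  by (rule Bochner_Integration.integrable_bound[OF integrable_X0])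
    (auto simp: excess_nonneg excess_le_abs)

text \<open>Dominated convergence: at each point the excess vanishes once \<open>e\<close> reaches
  \<open>\<bar>X0 \<omega>\<bar>\<close>, and this absolute value is an integrable majorant.\<close>

lemma expectation_excess_tendsto_0:
  "((\<lambda>e. expectation (\<lambda>\<omega>. excess e (X0 \<omega>))) \<longlongrightarrow> 0) at_top"
proof -
  have "((\<lambda>e. expectation (\<lambda>\<omega>. excess e (X0 \<omega>))) \<longlongrightarrow> expectation (\<lambda>_. 0)) at_top"
  proof (rule integral_dominated_convergence_at_top[where w = "\<lambda>\<omega>. \<bar>X0 \<omega>\<bar>"])
    show "AE \<omega> in M. ((\<lambda>e. excess e (X0 \<omega>)) \<longlongrightarrow> 0) at_top"
    proof (rule AE_I2)
      fix \<omega>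
      have "eventually (\<lambda>e. excess e (X0 \<omega>) = 0) at_top"
        using eventually_ge_at_top[of "\<bar>X0 \<omega>\<bar>"] by eventually_elim (simp add: excess_def)
      then show "((\<lambda>e. excess e (X0 \<omega>)) \<longlongrightarrow> 0) at_top"
        by (rule tendsto_eventually)
    qed
  qed (use integrable_X0 in \<open>auto simp: excess_nonneg excess_le_abs\<close>)
  then show ?thesis by simp
qed

text \<open>A union bound over \<open>k \<le> n\<close> suffices because Hoeffding's bounds are exponentially small.\<close>

lemma maximal_wlln_bounded:
  fixes g :: "real \<Rightarrow> real"
  assumes g [measurable]: "g \<in> borel_measurable borel"
    and C: "\<And>x. \<bar>g x\<bar> \<le> C" "C > 0" and \<delta>: "\<delta> > 0"
  defines "m \<equiv> expectation (\<lambda>\<omega>. g (X0 \<omega>))"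
  shows "(\<lambda>n. prob {\<omega> \<in> space M. \<exists>k\<le>n. \<delta> * real n < \<bar>(\<Sum>j=1..k. g (X j \<omega>)) - m * real k\<bar>}) \<longlonglongrightarrow> 0"
    (is "(\<lambda>n. prob (?A n)) \<longlonglongrightarrow> 0")
proof -
  \<comment> \<open>Hoeffding's exponent for variables in \<open>[-C, C]\<close> decreases in
    \<open>k\<close>; its value in the worst case \<open>k = n\<close> is
    \<open>c * n\<close>.\<close>
  define c where "c = \<delta>\<^sup>2 / (2 * C\<^sup>2)"
  have "c > 0"
    using C(2) \<delta> by (simp add: c_def)
  then have lim: "(\<lambda>n. real n * (2 * exp (- c * real n))) \<longlonglongrightarrow> 0"
    by real_asymp
  have le: "prob (?A n) \<le> real n * (2 * exp (- c * real n))" for n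
  proof -
    define B where "B k = {\<omega> \<in> space M. \<delta> * real n \<le> \<bar>(\<Sum>j=1..k. g (X j \<omega>)) - real k * m\<bar>}" for k
    have [measurable]: "B k \<in> events" for k
      unfolding B_def by measurable
    have "?A n \<subseteq> (\<Union>k\<in>{1..n}. B k)"
    proof
      fix \<omega> assume "\<omega> \<in> ?A n"
      then obtain k where k: "\<omega> \<in> space M" "k \<le> n" "\<delta> * real n < \<bar>(\<Sum>j=1..k. g (X j \<omega>)) - m * real k\<bar>"
        by auto
      \<comment> \<open>The empty sum has deviation 0, so the union bound can start at
        \<open>k = 1\<close>.\<close>
      have "k \<noteq> 0"
        using k(3) \<delta> by (intro notI) (simp add: mult_less_0_iff)
      with k show "\<omega> \<in> (\<Union>k\<in>{1..n}. B k)"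
        by (auto simp: B_def mult.commute intro!: bexI[of _ k])
    qed
    then have "prob (?A n) \<le> prob (\<Union>k\<in>{1..n}. B k)"
      by (intro finite_measure_mono) auto
    also have "\<dots> \<le> (\<Sum>k=1..n. prob (B k))"
      by (intro finite_measure_subadditive_finite) auto
    also have "\<dots> \<le> (\<Sum>k=1..n. 2 * exp (- c * real n))"
    proof (rule sum_mono)
      fix k assume k: "k \<in> {1..n}"
      interpret H: Hoeffding_ineq_iid M "{1..k}" "\<lambda>j \<omega>. g (X j \<omega>)" "\<lambda>\<omega>. g (X0 \<omega>)" "- C" C m
      proof unfold_locales
        show "indep_vars (\<lambda>_. borel) (\<lambda>j \<omega>. g (X j \<omega>)) {1..k}"
          by (rule indep_vars_compose2[OF indep_vars_subset[OF indep]]) auto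
        show "AE \<omega> in M. g (X0 \<omega>) \<in> {- C..C}"
          using C(1) by (auto simp: abs_le_iff intro!: AE_I2) (metis minus_le_iff)
        show "m \<equiv> expectation (\<lambda>\<omega>. g (X0 \<omega>))"
          by (rule m_def)
      qed (auto intro: distr_comp)
      have "prob (B k) \<le> 2 * exp (- 2 * (\<delta> * real n)\<^sup>2 / (real k * (C - - C)\<^sup>2))"
        using H.Hoeffding_ineq_abs_ge[of "\<delta> * real n"] k \<delta> C(2) by (simp add: B_def)
      also have "c * real n \<le> 2 * (\<delta> * real n)\<^sup>2 / (real k * (C - - C)\<^sup>2)"
      proof -
        have "c * real n = 2 * (\<delta> * real n)\<^sup>2 / (real n * (2 * C)\<^sup>2)"
          using k C(2) by (simp add: c_def field_simps power2_eq_square)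
        also have "\<dots> \<le> 2 * (\<delta> * real n)\<^sup>2 / (real k * (2 * C)\<^sup>2)"
          using k C(2) by (intro divide_left_mono mult_right_mono mult_pos_pos) auto
        finally show ?thesis by simp
      qed
      then have "2 * exp (- 2 * (\<delta> * real n)\<^sup>2 / (real k * (C - - C)\<^sup>2)) \<le> 2 * exp (- c * real n)"
        by simp
      finally show "prob (B k) \<le> 2 * exp (- c * real n)" .
    qed
    finally show ?thesis by simp
  qed
  show ?thesis
    by (rule tendsto_sandwich[OF _ _ tendsto_const lim]) (use le in auto)
qed

text \<open>Truncation at \<open>K\<close> reduces this to the bounded case; the remainder is controlled by Markov.\<close>

lemma maximal_wlln:
  assumes \<delta>: "\<delta> > 0"
  defines "m \<equiv> expectation X0"
  shows "(\<lambda>n. prob {\<omega> \<in> space M. \<exists>k\<le>n. \<delta> * real n < \<bar>(\<Sum>j=1..k. X j \<omega>) - m * real k\<bar>}) \<longlonglongrightarrow> 0"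
    (is "(\<lambda>n. prob (?A n)) \<longlonglongrightarrow> 0")
proof (rule tendstoI)
  fix \<rho> :: real assume \<rho>: "\<rho> > 0"
  \<comment> \<open>The term \<open>\<delta> / 4\<close> bounds the shift of the mean by truncation;
    \<open>\<rho> * \<delta> / 8\<close> makes the Markov bound \<open>4 * q / \<delta>\<close> at
    most \<open>\<rho> / 2\<close>.\<close>
  define q where "q = min (\<delta> / 4) (\<rho> * \<delta> / 8)"
  have "q > 0"
    using \<rho> \<delta> by (simp add: q_def)
  have "\<forall>\<^sub>F K in at_top. expectation (\<lambda>\<omega>. excess K (X0 \<omega>)) < q \<and> K > 0"
    using order_tendstoD(2)[OF expectation_excess_tendsto_0 \<open>q > 0\<close>] eventually_gt_at_top[of 0]
    by eventually_elim auto
  then obtain K where K: "expectation (\<lambda>\<omega>. excess K (X0 \<omega>)) < q" "K > 0"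
    using eventually_happens'[OF trivial_limit_at_top_linorder] by blast
  define g :: "real \<Rightarrow> real" where "g x = (if \<bar>x\<bar> \<le> K then x else 0)" for x
  have [measurable]: "g \<in> borel_measurable borel"
    unfolding g_def[abs_def] by measurable
  have g: "\<bar>g x\<bar> \<le> K" "\<bar>x - g x\<bar> = excess K x" for x
    using K(2) by (auto simp: g_def excess_def)
  have int_g: "integrable M (\<lambda>\<omega>. g (X0 \<omega>))"
    by (rule integrable_const_bound[where B = K]) (use g in auto)
  define m' where "m' = expectation (\<lambda>\<omega>. g (X0 \<omega>))"
  have "m - m' = expectation (\<lambda>\<omega>. X0 \<omega> - g (X0 \<omega>))"
    using integrable_X0 int_g by (simp add: m_def m'_def)
  also have "\<bar>\<dots>\<bar> \<le> expectation (\<lambda>\<omega>. \<bar>X0 \<omega> - g (X0 \<omega>)\<bar>)"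
    by (rule integral_abs_bound)
  finally have m: "\<bar>m - m'\<bar> \<le> q"
    using K(1) by (simp add: g)
  \<comment> \<open>The deviation \<open>\<delta> * n\<close> is split into
    \<open>\<delta> / 4\<close> for the truncated-off part, \<open>\<delta> / 2\<close> for the
    bounded part and \<open>\<delta> / 4\<close> for the shift of the mean.\<close>
  define B1 where "B1 n = {\<omega> \<in> space M. \<delta> / 4 * real n \<le> (\<Sum>j=1..n. excess K (X j \<omega>))}" for n
  define B2 where "B2 n = {\<omega> \<in> space M. \<exists>k\<le>n. \<delta> / 2 * real n < \<bar>(\<Sum>j=1..k. g (X j \<omega>)) - m' * real k\<bar>}" for n
  have [measurable]: "B1 n \<in> events" "B2 n \<in> events" for n
    unfolding B1_def B2_def by measurable
  have sub: "?A n \<subseteq> B1 n \<union> B2 n" for n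
  proof (rule subsetI, rule ccontr)
    fix \<omega> assume "\<omega> \<in> ?A n" and nB: "\<omega> \<notin> B1 n \<union> B2 n"
    then obtain k where k: "\<omega> \<in> space M" "k \<le> n" "\<delta> * real n < \<bar>(\<Sum>j=1..k. X j \<omega>) - m * real k\<bar>"
      by auto
    have 1: "(\<Sum>j=1..n. excess K (X j \<omega>)) < \<delta> / 4 * real n"
      and 2: "\<bar>(\<Sum>j=1..k. g (X j \<omega>)) - m' * real k\<bar> \<le> \<delta> / 2 * real n"
      using nB k by (auto simp: B1_def B2_def not_less)
    have "\<bar>(\<Sum>j=1..k. X j \<omega>) - (\<Sum>j=1..k. g (X j \<omega>))\<bar> \<le> (\<Sum>j=1..k. excess K (X j \<omega>))"
      unfolding sum_subtractf[symmetric] g(2)[symmetric] by (rule sum_abs)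
    also have "\<dots> \<le> (\<Sum>j=1..n. excess K (X j \<omega>))"
      using k(2) by (intro sum_mono2) (auto simp: excess_nonneg)
    finally have 3: "\<bar>(\<Sum>j=1..k. X j \<omega>) - (\<Sum>j=1..k. g (X j \<omega>))\<bar> < \<delta> / 4 * real n"
      using 1 by simp
    have "\<bar>m * real k - m' * real k\<bar> = \<bar>m - m'\<bar> * real k"
      by (simp add: abs_mult flip: left_diff_distrib)
    also have "\<dots> \<le> \<delta> / 4 * real n"
      using m k(2) \<delta> by (intro mult_mono) (auto simp: q_def)
    finally show False
      using k(3) 2 3 by linarith
  qed
  have B1: "prob (B1 n) \<le> \<rho> / 2" if "n > 0" for n
  proof -
    have "prob (B1 n) \<le> real n * expectation (\<lambda>\<omega>. excess K (X0 \<omega>)) / (\<delta> / 4 * real n)"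
      unfolding B1_def using that \<delta>
      by (intro prob_sum_ge_le integrable_excess) (auto simp: excess_nonneg)
    also have "\<dots> = 4 * expectation (\<lambda>\<omega>. excess K (X0 \<omega>)) / \<delta>"
      using that by simp
    also have "\<dots> \<le> \<rho> / 2"
      using K(1) \<delta> by (simp add: q_def field_simps)
    finally show ?thesis .
  qed
  have "(\<lambda>n. prob (B2 n)) \<longlonglongrightarrow> 0"
    unfolding B2_def m'_def using g(1) K(2) \<delta> by (intro maximal_wlln_bounded[where C = K]) auto
  then have "\<forall>\<^sub>F n in sequentially. prob (B2 n) < \<rho> / 2"
    using order_tendstoD(2) \<rho> by (metis half_gt_zero)
  then show "\<forall>\<^sub>F n in sequentially. dist (prob (?A n)) 0 < \<rho>"
    using eventually_gt_at_top[of 0]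
  proof eventually_elim
    case (elim n)
    have "prob (?A n) \<le> prob (B1 n \<union> B2 n)"
      using sub by (intro finite_measure_mono) auto
    also have "\<dots> \<le> prob (B1 n) + prob (B2 n)"
      by (intro measure_Un_le) auto
    also have "\<dots> < \<rho>"
      using elim B1[of n] by simp
    finally show ?case by simp
  qed
qed

text \<open>Outside the events \<open>B\<close> (large overshoot) and \<open>L\<close> (failure of
  the maximal law) \<open>mu_hat_close\<close> applies. The event \<open>last_crossing = 0\<close>
  is included in the bad set so that undefined values of the estimator are covered too.\<close>

lemma mu_hat_tendsto:
  fixes \<Delta> :: "'i \<Rightarrow> real" and t :: "'i \<Rightarrow> nat"
  defines "m \<equiv> expectation X0"
  assumes "m > 0" and \<eta>: "\<eta> > 0" and \<Delta>_pos: "\<And>i. \<Delta> i > 0"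
    and \<Delta>: "filterlim \<Delta> at_top F" and t: "filterlim t at_top F"
    and o: "\<Delta> \<in> o[F](\<lambda>i. real (t i))"
  shows "((\<lambda>i. prob {\<omega> \<in> space M. last_crossing (path_S X \<omega>) (\<Delta> i) (t i) = 0 \<or>
      \<eta> < \<bar>mu_hat X (\<Delta> i) (t i) \<omega> - m\<bar>}) \<longlongrightarrow> 0) F"
    (is "((\<lambda>i. prob (?A i)) \<longlongrightarrow> 0) F")
proof (rule tendstoI)
  fix \<rho> :: real assume \<rho>: "\<rho> > 0"
  define \<delta> where "\<delta> = min (\<eta> / 4) (m / 6)"
  have \<delta>: "\<delta> > 0" "6 * \<delta> \<le> m" "4 * \<delta> \<le> \<eta>"
    using \<eta> \<open>m > 0\<close> by (auto simp: \<delta>_def)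
  define E where "E = expectation (\<lambda>\<omega>. \<bar>X0 \<omega>\<bar>)"
  have "E \<ge> 0"
    by (simp add: E_def)
  \<comment> \<open>Chosen so that the small-jump part \<open>\<epsilon> * E / \<delta>\<close> of
    the Markov bound is at most \<open>\<rho> / 3\<close>; \<open>E + 1\<close> keeps the
    denominator positive.\<close>
  define \<epsilon> where "\<epsilon> = \<rho> * \<delta> / (3 * (E + 1))"
  have "\<epsilon> * E / \<delta> = \<rho> / 3 * (E / (E + 1))"
    using \<delta>(1) by (simp add: \<epsilon>_def)
  also have "\<dots> \<le> \<rho> / 3"
    using \<rho> \<open>E \<ge> 0\<close> by (intro mult_left_le) auto
  finally have \<epsilon>: "\<epsilon> > 0" "\<epsilon> * E / \<delta> \<le> \<rho> / 3"
    using \<rho> \<delta>(1) \<open>E \<ge> 0\<close> by (auto simp: \<epsilon>_def)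
  \<comment> \<open>Both overshoot terms of \<open>mu_hat_close\<close> are merged into one
    nonnegative summand, so a single Markov bound handles them.\<close>
  define g where "g i x = \<epsilon> * \<bar>x\<bar> + excess (\<epsilon> * \<Delta> i) x" for i x
  have [measurable]: "g i \<in> borel_measurable borel" for i
    unfolding g_def[abs_def] by measurable
  have g_nonneg: "0 \<le> g i x" for i x
    using \<epsilon>(1) by (simp add: g_def excess_nonneg)
  have int_g: "integrable M (\<lambda>\<omega>. g i (X0 \<omega>))" for i
    unfolding g_def using integrable_X0 by (auto intro!: integrable_excess)
  define h where "h i = expectation (\<lambda>\<omega>. excess (\<epsilon> * \<Delta> i) (X0 \<omega>))" for i
  have Eg: "expectation (\<lambda>\<omega>. g i (X0 \<omega>)) = \<epsilon> * E + h i" for i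
    unfolding g_def E_def h_def using integrable_X0 integrable_excess by simp
  define B where "B i = {\<omega> \<in> space M. \<delta> * real (t i) \<le> (\<Sum>k=1..t i. g i (X k \<omega>))}" for i
  define L where "L i = {\<omega> \<in> space M. \<exists>k\<le>t i. \<delta> * real (t i) < \<bar>(\<Sum>j=1..k. X j \<omega>) - m * real k\<bar>}" for i
  have [measurable]: "B i \<in> events" "L i \<in> events" for i
    unfolding B_def L_def by measurable
  have "((\<lambda>i. prob (L i)) \<longlongrightarrow> 0) F"
    unfolding L_def m_def using filterlim_compose[OF maximal_wlln[OF \<delta>(1)] t] .
  then have L: "\<forall>\<^sub>F i in F. prob (L i) < \<rho> / 3"
    using \<rho> by (intro order_tendstoD(2)) auto
  \<comment> \<open>Here \<open>\<Delta>\<close> tending to infinity matters: the jump threshold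
    diverges, so the tail expectation \<open>h\<close> vanishes.\<close>
  have "filterlim (\<lambda>i. \<epsilon> * \<Delta> i) at_top F"
    using filterlim_tendsto_pos_mult_at_top[OF tendsto_const \<epsilon>(1) \<Delta>] .
  then have "(h \<longlongrightarrow> 0) F"
    unfolding h_def[abs_def] by (rule filterlim_compose[OF expectation_excess_tendsto_0])
  then have h: "\<forall>\<^sub>F i in F. h i < \<rho> * \<delta> / 3"
    using \<rho> \<delta>(1) by (intro order_tendstoD(2)) auto
  have small: "\<forall>\<^sub>F i in F. \<Delta> i \<le> \<delta> * real (t i)"
    using landau_o.smallD[OF o \<delta>(1)] by eventually_elim auto
  have pos: "\<forall>\<^sub>F i in F. t i > 0"
    using t eventually_gt_at_top by (metis filterlim_iff)
  from L h small pos show "\<forall>\<^sub>F i in F. dist (prob (?A i)) 0 < \<rho>"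
  proof eventually_elim
    case (elim i)
    have "?A i \<subseteq> B i \<union> L i"
    proof (rule subsetI, rule ccontr)
      fix \<omega> assume A: "\<omega> \<in> ?A i" and nB: "\<omega> \<notin> B i \<union> L i"
      have "\<bar>path_S X \<omega> k - m * real k\<bar> \<le> \<delta> * real (t i)" if "k \<le> t i" for k
        using A nB that by (auto simp: L_def path_S_def not_less)
      moreover have "\<epsilon> * (\<Sum>k=1..t i. \<bar>X k \<omega>\<bar>) + (\<Sum>k=1..t i. excess (\<epsilon> * \<Delta> i) (X k \<omega>)) \<le> \<delta> * real (t i)"
        using A nB by (auto simp: B_def g_def sum.distrib sum_distrib_left not_le)
      ultimately have "last_crossing (path_S X \<omega>) (\<Delta> i) (t i) \<noteq> 0"
          "\<bar>mu_hat X (\<Delta> i) (t i) \<omega> - m\<bar> \<le> 4 * \<delta>"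
        using \<Delta>_pos[of i] \<delta> \<epsilon>(1) \<open>m > 0\<close> elim mu_hat_close[of "\<Delta> i" \<delta> \<epsilon> m "t i" X \<omega>] by auto
      with A \<delta>(3) show False by auto
    qed
    then have "prob (?A i) \<le> prob (B i \<union> L i)"
      by (intro finite_measure_mono) auto
    also have "\<dots> \<le> prob (B i) + prob (L i)"
      by (intro measure_Un_le) auto
    \<comment> \<open>The factor \<open>t i\<close> cancels. Small jumps, large jumps and
      \<open>L\<close> then take a third of \<open>\<rho>\<close> each.\<close>
    also have "prob (B i) \<le> real (t i) * (\<epsilon> * E + h i) / (\<delta> * real (t i))"
      unfolding B_def Eg[symmetric] using elim \<delta>(1) g_nonneg int_g
      by (intro prob_sum_ge_le) auto
    also have "\<dots> = \<epsilon> * E / \<delta> + h i / \<delta>"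
      using elim by (simp add: add_divide_distrib)
    also have "h i / \<delta> < \<rho> / 3"
      using elim \<delta>(1) by (simp add: field_simps)
    finally have "prob (?A i) < \<rho>"
      using elim(1) \<epsilon>(2) by linarith
    then show ?case by simp
  qed
qed

end

section \<open>From the two mean estimates to the square root\<close>

lemma sqrt_diff_le:
  fixes r \<sigma> :: real
  assumes "r \<ge> 0" "\<sigma> > 0"
  shows "\<bar>sqrt r - \<sigma>\<bar> \<le> \<bar>r - \<sigma>\<^sup>2\<bar> / \<sigma>"
proof -
  \<comment> \<open>The conjugate factor \<open>sqrt r + \<sigma>\<close> is at least
    \<open>\<sigma>\<close>, and the product with it is a difference of squares.\<close>
  have "\<bar>sqrt r - \<sigma>\<bar> * \<sigma> \<le> \<bar>sqrt r - \<sigma>\<bar> * (sqrt r + \<sigma>)"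
    using assms by (intro mult_left_mono) auto
  also have "\<dots> = \<bar>(sqrt r - \<sigma>) * (sqrt r + \<sigma>)\<bar>"
    using assms by (simp add: abs_mult)
  also have "(sqrt r - \<sigma>) * (sqrt r + \<sigma>) = r - \<sigma>\<^sup>2"
    using assms(1) by (simp add: algebra_simps power2_eq_square)
  finally show ?thesis
    using assms(2) by (simp add: field_simps)
qed

theorem theorem3p4:
  fixes M :: "'a measure"
    and X :: "nat \<Rightarrow> 'a \<Rightarrow> real"
    and X\<^sub>0 :: "'a \<Rightarrow> real"
    and \<mu> \<sigma> c :: real
    and F :: "'i filter"
    and \<Delta> \<Gamma> :: "'i \<Rightarrow> real"
    and t :: "'i \<Rightarrow> nat"
  assumes "prob_space M"
    and "X\<^sub>0 \<in> borel_measurable M"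
    and "prob_space.indep_vars M (\<lambda>_. borel) X {1..}"
    and "\<And>k. k \<ge> 1 \<Longrightarrow> distr M borel (X k) = distr M borel X\<^sub>0"
    and "integrable M X\<^sub>0"
    and "integrable M (\<lambda>\<omega>. (X\<^sub>0 \<omega>)\<^sup>2)"
    and "\<mu> = integral\<^sup>L M X\<^sub>0"
    and "\<mu> > 0"
    and "\<sigma> = sqrt (integral\<^sup>L M (\<lambda>\<omega>. (X\<^sub>0 \<omega> - \<mu>)\<^sup>2))"
    and "\<sigma> > 0"
    and "integrable M (\<lambda>\<omega>. \<bar>X\<^sub>0 \<omega>\<bar> ^ 3)"
    and "\<And>i. \<Delta> i > 0"
    and "\<And>i. \<Gamma> i > 0"
    and "filterlim \<Delta> at_top F"
    and "filterlim \<Gamma> at_top F"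
    and "filterlim t at_top F"
    and "\<Delta> \<in> o[F](\<lambda>i. real (t i))"
    and "\<Gamma> \<in> o[F](\<lambda>i. real (t i))"
  shows "tendsto_in_prob M (\<lambda>i. sigma_hat c X (\<Delta> i) (\<Gamma> i) (t i)) \<sigma> F"
proof -
  interpret prob_space M by fact
  interpret S: iid_sequence M X X\<^sub>0
    by unfold_locales (use assms in auto)
  interpret Z: iid_sequence M "\<lambda>k \<omega>. (X k \<omega>)\<^sup>2" "\<lambda>\<omega>. (X\<^sub>0 \<omega>)\<^sup>2"
  proof unfold_locales
    show "indep_vars (\<lambda>_. borel) (\<lambda>k \<omega>. (X k \<omega>)\<^sup>2) {1..}"
      by (rule indep_vars_compose2[OF S.indep]) auto
  qed (use assms S.distr_comp[of "\<lambda>x. x\<^sup>2"] in auto)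
  let ?q = "expectation (\<lambda>\<omega>. (X\<^sub>0 \<omega>)\<^sup>2)"
  have [measurable]: "(\<lambda>\<omega>. path_S X \<omega> s) \<in> borel_measurable M"
      "(\<lambda>\<omega>. path_S (\<lambda>k \<omega>. (X k \<omega>)\<^sup>2) \<omega> s) \<in> borel_measurable M" for s
    unfolding path_S_def by measurable
  \<comment> \<open>This makes the first term of the radicand an instance of \<open>mu_hat\<close>
    for the squares.\<close>
  have path_Z: "path_Z X \<omega> = path_S (\<lambda>k \<omega>. (X k \<omega>)\<^sup>2) \<omega>" for \<omega>
    by (auto simp: path_S_def path_Z_def)
  have "integral\<^sup>L M (\<lambda>\<omega>. (X\<^sub>0 \<omega> - \<mu>)\<^sup>2) = ?q - \<mu>\<^sup>2"
    using variance_eq[OF assms(5,6)] assms(7) by simp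
  then have \<sigma>2: "\<sigma>\<^sup>2 = ?q - \<mu>\<^sup>2"
    using assms(9,10) by simp
  then have q_pos: "?q > 0"
    using \<open>\<sigma> > 0\<close> \<open>\<mu> > 0\<close> by (metis add_pos_pos diff_add_cancel zero_less_power)
  show ?thesis
    unfolding tendsto_in_prob_def
  proof (intro conjI allI impI)
    show "sigma_hat c X (\<Delta> i) (\<Gamma> i) (t i) \<in> borel_measurable M" for i
      by (rule borel_measurable_sigma_hat) (rule S.measurable_X)
    fix \<epsilon> :: real assume \<epsilon>: "\<epsilon> > 0"
    \<comment> \<open>The cap \<open>\<sigma> / 2\<close> keeps the radicand nonnegative. In
      \<open>\<eta>\<close>, the factor \<open>2 + 2 * \<mu>\<close> collects the error
      \<open>\<eta>\<close> of the second moment and \<open>\<eta> * (1 + 2 * \<mu>)\<close> of the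
      squared mean, where \<open>\<eta> \<le> 1\<close> is used.\<close>
    define \<kappa> where "\<kappa> = min \<epsilon> (\<sigma> / 2)"
    define \<eta> where "\<eta> = min 1 (\<sigma> * \<kappa> / (2 + 2 * \<mu>))"
    have \<kappa>: "\<kappa> > 0" "\<kappa> \<le> \<epsilon>" "\<kappa> \<le> \<sigma> / 2"
      using \<epsilon> \<open>\<sigma> > 0\<close> by (auto simp: \<kappa>_def)
    have "\<eta> \<le> \<sigma> * \<kappa> / (2 + 2 * \<mu>)"
      by (simp add: \<eta>_def)
    then have "\<eta> * (2 + 2 * \<mu>) \<le> \<sigma> * \<kappa>"
      using \<open>\<mu> > 0\<close> by (simp add: pos_le_divide_eq)
    moreover have "\<eta> > 0" "\<eta> \<le> 1"
      using \<kappa>(1) \<open>\<sigma> > 0\<close> \<open>\<mu> > 0\<close> by (auto simp: \<eta>_def)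
    ultimately have \<eta>: "\<eta> > 0" "\<eta> \<le> 1" "\<eta> * (2 + 2 * \<mu>) \<le> \<sigma> * \<kappa>"
      by auto
    let ?A = "\<lambda>i. {\<omega> \<in> space M. last_crossing (path_S X \<omega>) (\<Delta> i) (t i) = 0 \<or>
      \<eta> < \<bar>mu_hat X (\<Delta> i) (t i) \<omega> - \<mu>\<bar>}"
    let ?B = "\<lambda>i. {\<omega> \<in> space M. last_crossing (path_S (\<lambda>k \<omega>. (X k \<omega>)\<^sup>2) \<omega>) (\<Gamma> i) (t i) = 0 \<or>
      \<eta> < \<bar>mu_hat (\<lambda>k \<omega>. (X k \<omega>)\<^sup>2) (\<Gamma> i) (t i) \<omega> - ?q\<bar>}"
    let ?C = "\<lambda>i. {\<omega> \<in> space M. \<epsilon> < \<bar>sigma_hat c X (\<Delta> i) (\<Gamma> i) (t i) \<omega> - \<sigma>\<bar>}"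
    have [measurable]: "?A i \<in> events" "?B i \<in> events" for i
      unfolding mu_hat_def by measurable
    have "((\<lambda>i. prob (?A i) + prob (?B i)) \<longlongrightarrow> 0 + 0) F"
    proof (rule tendsto_add)
      show "((\<lambda>i. prob (?A i)) \<longlongrightarrow> 0) F"
        unfolding assms(7) using assms(8) assms(12-) \<eta>(1)
        by (intro S.mu_hat_tendsto) (auto simp: assms(7))
      show "((\<lambda>i. prob (?B i)) \<longlongrightarrow> 0) F"
        using q_pos assms(12-) \<eta>(1) by (intro Z.mu_hat_tendsto) auto
    qed
    then have lim: "((\<lambda>i. prob (?A i) + prob (?B i)) \<longlongrightarrow> 0) F"
      by simp
    \<comment> \<open>Off \<open>?A i\<close> and \<open>?B i\<close> both last crossings are
      nonzero and the radicand is nonnegative, so the default \<open>c\<close> is never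
      taken.\<close>
    have sub: "?C i \<subseteq> ?A i \<union> ?B i" for i
    proof (rule subsetI, rule ccontr)
      fix \<omega> assume C: "\<omega> \<in> ?C i" and nAB: "\<omega> \<notin> ?A i \<union> ?B i"
      define a b where "a = mu_hat X (\<Delta> i) (t i) \<omega>"
        and "b = mu_hat (\<lambda>k \<omega>. (X k \<omega>)\<^sup>2) (\<Gamma> i) (t i) \<omega>"
      have a: "\<bar>a - \<mu>\<bar> \<le> \<eta>" and b: "\<bar>b - ?q\<bar> \<le> \<eta>"
        and ne: "last_crossing (path_S X \<omega>) (\<Delta> i) (t i) \<noteq> 0"
          "last_crossing (path_Z X \<omega>) (\<Gamma> i) (t i) \<noteq> 0"
        using C nAB by (auto simp: a_def b_def path_Z)
      have r: "sigma_hat_sq X (\<Delta> i) (\<Gamma> i) (t i) \<omega> = b - a\<^sup>2"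
        by (simp add: sigma_hat_sq_def a_def b_def mu_hat_def path_Z mult.commute)
      have "\<bar>a\<^sup>2 - \<mu>\<^sup>2\<bar> = \<bar>a - \<mu>\<bar> * \<bar>a + \<mu>\<bar>"
        by (simp add: abs_mult[symmetric] algebra_simps power2_eq_square)
      also have "\<dots> \<le> \<eta> * (1 + 2 * \<mu>)"
        using a \<eta>(2) \<open>\<mu> > 0\<close> by (intro mult_mono) auto
      finally have "\<bar>(b - a\<^sup>2) - \<sigma>\<^sup>2\<bar> \<le> \<eta> + \<eta> * (1 + 2 * \<mu>)"
        using b \<sigma>2 by linarith
      also have "\<dots> = \<eta> * (2 + 2 * \<mu>)"
        by (simp add: algebra_simps)
      finally have close: "\<bar>(b - a\<^sup>2) - \<sigma>\<^sup>2\<bar> \<le> \<sigma> * \<kappa>"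
        using \<eta>(3) by linarith
      have "\<sigma> * \<kappa> \<le> \<sigma> * (\<sigma> / 2)"
        using \<kappa>(3) \<open>\<sigma> > 0\<close> by (intro mult_left_mono) auto
      also have "\<dots> \<le> \<sigma>\<^sup>2"
        by (simp add: power2_eq_square)
      finally have nonneg: "b - a\<^sup>2 \<ge> 0"
        using close by linarith
      have "\<bar>sqrt (b - a\<^sup>2) - \<sigma>\<bar> \<le> \<bar>(b - a\<^sup>2) - \<sigma>\<^sup>2\<bar> / \<sigma>"
        by (rule sqrt_diff_le[OF nonneg \<open>\<sigma> > 0\<close>])
      also have "\<dots> \<le> \<kappa>"
        using close \<open>\<sigma> > 0\<close> by (simp add: pos_divide_le_eq mult.commute)
      finally show False
        using C ne nonneg \<kappa>(2) by (simp add: sigma_hat_def r)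
    qed
    have le: "prob (?C i) \<le> prob (?A i) + prob (?B i)" for i
    proof -
      have "prob (?C i) \<le> prob (?A i \<union> ?B i)"
        by (rule finite_measure_mono[OF sub]) measurable
      also have "\<dots> \<le> prob (?A i) + prob (?B i)"
        by (rule measure_Un_le) measurable
      finally show ?thesis .
    qed
    show "((\<lambda>i. prob (?C i)) \<longlongrightarrow> 0) F"
      by (rule tendsto_sandwich[OF _ _ tendsto_const lim]) (use le in auto)
  qed
qed

end
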